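(* Let $R$ be an associative unital ring. Then the lower nilradical $\operatorname{Nil}_*(R)$ coincides with the intersection of all the fully integrally closed left ideals of $R$.
   Context: Rings are associative and unital, not necessarily commutative. The lower nilradical $\operatorname{Nil}_*(R)$ is the intersection of all semiprime two-sided ideals of $R$, where a two-sided ideal $I$ is semiprime if, for $a\in R$, $aRa\subseteq I$ implies $a\in I$. For a left ideal $I$ and elements $b_1,\dots,b_k\in R$, $Ib_1\cdots b_k=\{rb_1\cdots b_k\mid r\in I\}$ (equal to $I$ when $k=0$). A subset $A\subseteq R$ is fully integral over a left ideal $I$ if there exists $n\ge 1$ such that for all $a_1,\dots,a_n\in A$, $$a_1\cdots a_n\in \sum_{k=0}^{n-1}\ \sum_{1\le i_1,\dots,i_k\le n} I a_{i_1}\cdots a_{i_k}.$$ A left ideal $I$ of $R$ is fully integrally closed if no left ideal of $R$ properly containing $I$ is fully integral over $I$. *)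

theory Defs
  imports "HOL-Algebra.Algebra"
begin

locale left_ideal = additive_subgroup I R + ring R for I and R (structure) +
  assumes l_closed: "\<lbrakk>a \<in> I; x \<in> carrier R\<rbrakk> \<Longrightarrow> x \<otimes> a \<in> I"

definition semiprime_ideal :: "('a, 'b) ring_scheme \<Rightarrow> 'a set \<Rightarrow> bool" where
  "semiprime_ideal R I \<longleftrightarrow> ideal I R \<and>
     (\<forall>a \<in> carrier R. {a \<otimes>\<^bsub>R\<^esub> r \<otimes>\<^bsub>R\<^esub> a | r. r \<in> carrier R} \<subseteq> I \<longrightarrow> a \<in> I)"

definition lower_nilradical :: "('a, 'b) ring_scheme \<Rightarrow> 'a set" where
  "lower_nilradical R = \<Inter> {I. semiprime_ideal R I}"

definition list_mult :: "('a, 'b) ring_scheme \<Rightarrow> 'a list \<Rightarrow> 'a" where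
  "list_mult R bs = foldr (\<otimes>\<^bsub>R\<^esub>) bs \<one>\<^bsub>R\<^esub>"

(* I b_1 ... b_k; for the empty list this is I itself *)
definition set_list_mult :: "('a, 'b) ring_scheme \<Rightarrow> 'a set \<Rightarrow> 'a list \<Rightarrow> 'a set" where
  "set_list_mult R I bs = {foldl (\<otimes>\<^bsub>R\<^esub>) r bs | r. r \<in> I}"

(* The sum of finitely many subsets S w of R: all sums of one element from each S w.
   The index set W must be finite, since finsum is trivial on infinite sets. *)
definition sum_of_sets :: "('a, 'b) ring_scheme \<Rightarrow> 'c set \<Rightarrow> ('c \<Rightarrow> 'a set) \<Rightarrow> 'a set" where
  "sum_of_sets R W S = {finsum R f W | f. f \<in> Pi W S}"

(* The double sum over k < n and indices i_1, ..., i_k in {1..n} is taken as one sum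
   over the finite set of index words w = [i_1, ..., i_k] of length less than n. *)
definition fully_integral :: "('a, 'b) ring_scheme \<Rightarrow> 'a set \<Rightarrow> 'a set \<Rightarrow> bool" where
  "fully_integral R A I \<longleftrightarrow> A \<subseteq> carrier R \<and>
     (\<exists>n::nat. n \<ge> 1 \<and>
       (\<forall>a \<in> {1..n} \<rightarrow> A.
          list_mult R (map a [1..<Suc n])
            \<in> sum_of_sets R {w. set w \<subseteq> {1..n} \<and> length w < n}
                 (\<lambda>w. set_list_mult R I (map a w))))"

definition fully_integrally_closed :: "('a, 'b) ring_scheme \<Rightarrow> 'a set \<Rightarrow> bool" where
  "fully_integrally_closed R I \<longleftrightarrow> left_ideal I R \<and>
     (\<nexists>J. left_ideal J R \<and> I \<subset> J \<and> fully_integral R J I)"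

end

theory Submission
  imports Defs
begin

text \<open>
  Both inclusions come from comparing fully integrally closed left ideals with semiprime ideals.

  A semiprime ideal \<open>P\<close> is itself fully integrally closed. Since \<open>P\<close> is two-sided, an integral
  relation over \<open>P\<close> for a left ideal \<open>J\<close> says just that all \<open>n\<close>-fold products from \<open>J\<close> lie in \<open>P\<close>,
  that is, \<open>J\<close> is nilpotent modulo \<open>P\<close>; semiprimeness then forces \<open>J \<subseteq> P\<close>. Hence the intersection
  of the fully integrally closed left ideals lies in the lower nilradical.

  Conversely, let \<open>I\<close> be a fully integrally closed left ideal. Its core, the largest two-sided
  ideal contained in \<open>I\<close>, is semiprime: if \<open>aRa\<close> lies in the core and \<open>c = ar\<close>, then all products
  of two elements of \<open>Rc\<close> lie in \<open>I\<close>, and this makes \<open>I + Rc\<close> fully integral over \<open>I\<close> with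
  \<open>n = 2\<close>. So \<open>Rc \<subseteq> I\<close> for every \<open>r\<close>, which puts \<open>a\<close> in the core. Therefore \<open>I\<close> contains a semiprime
  ideal, and with it the lower nilradical.
\<close>

lemma ideal_imp_left_ideal:
  assumes "ideal P R" shows "left_ideal P R"
proof -
  interpret ideal P R by fact
  show ?thesis by unfold_locales (rule I_l_closed)
qed

lemma left_ideal_principal:
  fixes R (structure)
  assumes "ring R" and c: "c \<in> carrier R"
  shows "left_ideal {s \<otimes> c | s. s \<in> carrier R} R"
proof -
  interpret ring R by fact
  have "subgroup {s \<otimes> c | s. s \<in> carrier R} (add_monoid R)"
  proof (rule add.subgroupI)
    fix x assume "x \<in> {s \<otimes> c | s. s \<in> carrier R}"
    then obtain s where "s \<in> carrier R" "x = s \<otimes> c" by blast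
    moreover from this have "\<ominus> x = (\<ominus> s) \<otimes> c" using c by (simp add: l_minus)
    ultimately show "\<ominus> x \<in> {s \<otimes> c | s. s \<in> carrier R}" by blast
  next
    fix x y assume "x \<in> {s \<otimes> c | s. s \<in> carrier R}" "y \<in> {s \<otimes> c | s. s \<in> carrier R}"
    then obtain s t where "s \<in> carrier R" "t \<in> carrier R" "x = s \<otimes> c" "y = t \<otimes> c" by blast
    moreover from this have "x \<oplus> y = (s \<oplus> t) \<otimes> c" using c by (simp add: l_distr)
    ultimately show "x \<oplus> y \<in> {s \<otimes> c | s. s \<in> carrier R}" by blast
  qed (use c in auto)
  then have "additive_subgroup {s \<otimes> c | s. s \<in> carrier R} R"
    by (rule additive_subgroup.intro)
  moreover have "x \<otimes> a \<in> {s \<otimes> c | s. s \<in> carrier R}"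
    if "a \<in> {s \<otimes> c | s. s \<in> carrier R}" and x: "x \<in> carrier R" for a x
  proof -
    from that obtain s where "s \<in> carrier R" "a = s \<otimes> c" by blast
    then have "x \<otimes> a = (x \<otimes> s) \<otimes> c" using x c by (simp add: m_assoc)
    then show ?thesis using x \<open>s \<in> carrier R\<close> by blast
  qed
  ultimately show ?thesis
    by (intro left_ideal.intro left_ideal_axioms.intro) (simp_all add: ring_axioms)
qed

lemma left_ideal_set_add:
  fixes R (structure)
  assumes "left_ideal I R" and "left_ideal J R"
  shows "left_ideal (I <+>\<^bsub>R\<^esub> J) R"
proof -
  interpret I: left_ideal I R by fact
  interpret J: left_ideal J R by fact
  have "additive_subgroup (I <+>\<^bsub>R\<^esub> J) R"
    by (rule I.add_additive_subgroups) unfold_locales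
  moreover have "x \<otimes> a \<in> I <+>\<^bsub>R\<^esub> J" if "a \<in> I <+>\<^bsub>R\<^esub> J" and x: "x \<in> carrier R" for a x
  proof -
    from that obtain i j where ij: "i \<in> I" "j \<in> J" "a = i \<oplus> j"
      by (auto simp: set_add_def')
    then have "x \<otimes> a = x \<otimes> i \<oplus> x \<otimes> j" using x by (simp add: I.r_distr)
    moreover have "x \<otimes> i \<in> I" "x \<otimes> j \<in> J"
      using ij x by (simp_all add: I.l_closed J.l_closed)
    ultimately show ?thesis unfolding set_add_def' by blast
  qed
  ultimately show ?thesis
    by (intro left_ideal.intro left_ideal_axioms.intro) (simp_all add: I.ring_axioms)
qed

lemma (in left_ideal) list_mult_closed:
  assumes "set xs \<subseteq> I" "xs \<noteq> []"
  shows "list_mult R xs \<in> I"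
  using assms
proof (induction xs)
  case (Cons x xs)
  then show ?case
    by (cases "xs = []") (auto simp: list_mult_def intro!: l_closed)
qed simp

lemma (in ring) list_mult_snoc:
  assumes "set xs \<subseteq> carrier R" "y \<in> carrier R"
  shows "list_mult R (xs @ [y]) = list_mult R xs \<otimes> y"
proof -
  have carr: "list_mult R ys \<in> carrier R" if "set ys \<subseteq> carrier R" for ys
    using that by (induction ys) (auto simp: list_mult_def)
  from assms show ?thesis
  proof (induction xs)
    case (Cons x xs)
    then show ?case using carr[of xs]
      by (simp add: list_mult_def m_assoc)
  qed (simp add: list_mult_def)
qed

section \<open>Semiprime ideals are fully integrally closed\<close>

text \<open>
  The length of the products drops one step at a time: a product \<open>p\<close> of \<open>n\<close> factors from \<open>J\<close>
  satisfies \<open>pRp \<subseteq> P\<close>, since \<open>p(rp)\<close> is \<open>p\<close> followed by the single further factor \<open>rp \<in> J\<close>.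
\<close>

lemma semiprime_contains_nilpotent_left_ideal:
  fixes R (structure)
  assumes P: "semiprime_ideal R P" and J: "left_ideal J R"
    and "n \<ge> 1"
    and "\<And>xs. set xs \<subseteq> J \<Longrightarrow> length xs = n \<Longrightarrow> list_mult R xs \<in> P"
  shows "J \<subseteq> P"
  using assms(3,4)
proof (induction n rule: nat_induct_at_least)
  interpret J: left_ideal J R by fact
  case base
  show ?case
  proof
    fix x assume "x \<in> J"
    then show "x \<in> P" using base[of "[x]"] by (simp add: list_mult_def)
  qed
next
  interpret J: left_ideal J R by fact
  case (Suc n)
  show ?case
  proof (rule Suc.IH)
    fix xs assume xs: "set xs \<subseteq> J" "length xs = n"
    let ?p = "list_mult R xs"
    have p: "?p \<in> J" using xs \<open>1 \<le> n\<close> by (intro J.list_mult_closed) auto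
    have "?p \<otimes> r \<otimes> ?p \<in> P" if r: "r \<in> carrier R" for r
    proof -
      have rp: "r \<otimes> ?p \<in> J" using J.l_closed[OF p r] .
      have "list_mult R (xs @ [r \<otimes> ?p]) \<in> P"
        using xs rp by (intro Suc.prems) auto
      moreover have "set xs \<subseteq> carrier R" using xs by auto
      ultimately show ?thesis using p r by (simp add: J.list_mult_snoc J.m_assoc)
    qed
    then have "{?p \<otimes> r \<otimes> ?p | r. r \<in> carrier R} \<subseteq> P" by auto
    moreover have "?p \<in> carrier R" using p by simp
    ultimately show "?p \<in> P" using P by (simp add: semiprime_ideal_def)
  qed
qed

lemma (in additive_subgroup) finsum_mem:
  assumes "abelian_group G" "f \<in> W \<rightarrow> H"
  shows "finsum G f W \<in> H"
proof -
  interpret abelian_group G by fact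
  show ?thesis using assms(2)
  proof (induction W rule: infinite_finite_induct)
    case (insert w W)
    moreover from this have "f \<in> W \<rightarrow> carrier G" "f w \<in> carrier G"
      using a_subset by blast+
    ultimately show ?case by (auto simp: finsum_insert)
  qed (auto simp: finsum_infinite)
qed

lemma (in ideal) foldl_mult_closed:
  "r \<in> I \<Longrightarrow> set bs \<subseteq> carrier R \<Longrightarrow> foldl (\<otimes>) r bs \<in> I"
  by (induction bs arbitrary: r) (auto simp: I_r_closed)

text \<open>
  Right multiplication does not lead out of a two-sided ideal \<open>P\<close>, so every summand
  \<open>P a\<^sub>i \<dots> a\<^sub>j\<close> of an integral relation is already part of \<open>P\<close>.
\<close>

lemma fully_integral_over_ideal_imp_nilpotent:
  fixes R (structure)
  assumes "ideal P R" and int: "fully_integral R A P"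
  obtains n where "n \<ge> 1"
    and "\<And>xs. set xs \<subseteq> A \<Longrightarrow> length xs = n \<Longrightarrow> list_mult R xs \<in> P"
proof -
  interpret ideal P R by fact
  from int obtain n where A: "A \<subseteq> carrier R" and n: "n \<ge> 1"
    and rel: "\<And>a. a \<in> {1..n} \<rightarrow> A \<Longrightarrow> list_mult R (map a [1..<Suc n])
        \<in> sum_of_sets R {w. set w \<subseteq> {1..n} \<and> length w < n} (\<lambda>w. set_list_mult R P (map a w))"
    unfolding fully_integral_def by auto
  have "list_mult R xs \<in> P" if xs: "set xs \<subseteq> A" "length xs = n" for xs
  proof -
    \<comment> \<open>The relation numbers its factors from 1, list positions start at 0.\<close>
    define a where "a = (\<lambda>i. xs ! (i - 1))"
    have map_a: "map a [1..<Suc n] = xs"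
      using xs(2) by (intro nth_equalityI) (auto simp: a_def simp del: upt_Suc)
    have a: "a \<in> {1..n} \<rightarrow> A"
      using xs by (auto simp: a_def Pi_iff intro!: subsetD[OF xs(1)] nth_mem)
    from rel[OF a] obtain f
      where f: "f \<in> Pi {w. set w \<subseteq> {1..n} \<and> length w < n} (\<lambda>w. set_list_mult R P (map a w))"
        and eq: "list_mult R xs = finsum R f {w. set w \<subseteq> {1..n} \<and> length w < n}"
      unfolding map_a sum_of_sets_def by blast
    have "f w \<in> P" if w: "w \<in> {w. set w \<subseteq> {1..n} \<and> length w < n}" for w
    proof -
      from f w have "f w \<in> set_list_mult R P (map a w)" by (rule Pi_mem)
      then obtain r where "r \<in> P" "f w = foldl (\<otimes>) r (map a w)"
        by (auto simp: set_list_mult_def)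
      moreover have "set (map a w) \<subseteq> carrier R" using a w A by (auto simp: Pi_iff subset_iff)
      ultimately show ?thesis by (simp only: foldl_mult_closed)
    qed
    then show ?thesis unfolding eq
      by (intro finsum_mem) (auto simp: abelian_group_axioms)
  qed
  with n show thesis by (rule that)
qed

lemma semiprime_ideal_fully_integrally_closed:
  fixes R (structure)
  assumes P: "semiprime_ideal R P"
  shows "fully_integrally_closed R P"
proof -
  have id: "ideal P R" using P by (simp add: semiprime_ideal_def)
  have "J \<subseteq> P" if J: "left_ideal J R" and "fully_integral R J P" for J
    using fully_integral_over_ideal_imp_nilpotent[OF id that(2)]
      semiprime_contains_nilpotent_left_ideal[OF P J] by metis
  then show ?thesis
    using ideal_imp_left_ideal[OF id] by (auto simp: fully_integrally_closed_def)
qed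

section \<open>The core of a fully integrally closed left ideal is semiprime\<close>

text \<open>
  For a left ideal \<open>I\<close>, the set of all \<open>x\<close> with \<open>xR \<subseteq> I\<close> is the largest two-sided ideal
  contained in \<open>I\<close>; it is also the annihilator of the left module \<open>R/I\<close>.
\<close>

definition left_ideal_core :: "('a, 'b) ring_scheme \<Rightarrow> 'a set \<Rightarrow> 'a set" where
  "left_ideal_core R I = {x \<in> carrier R. \<forall>r \<in> carrier R. x \<otimes>\<^bsub>R\<^esub> r \<in> I}"

lemma (in left_ideal) left_ideal_core_subset: "left_ideal_core R I \<subseteq> I"
proof
  fix x assume "x \<in> left_ideal_core R I"
  then have "x \<in> carrier R" "x \<otimes> \<one> \<in> I"
    using one_closed unfolding left_ideal_core_def by blast+
  then show "x \<in> I" by simp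
qed

lemma (in left_ideal) ideal_left_ideal_core: "ideal (left_ideal_core R I) R"
proof (rule idealI)
  show "subgroup (left_ideal_core R I) (add_monoid R)"
  proof (rule add.subgroupI)
    have "\<zero> \<in> left_ideal_core R I" by (simp add: left_ideal_core_def)
    then show "left_ideal_core R I \<noteq> {}" by blast
  qed (auto simp: left_ideal_core_def l_minus l_distr)
qed (auto simp: left_ideal_core_def m_assoc l_closed ring_axioms)

text \<open>
  Write two elements as \<open>i\<^sub>1 + k\<^sub>1\<close> and \<open>i\<^sub>2 + k\<^sub>2\<close>. Their product is
  \<open>(k\<^sub>1 i\<^sub>2 + k\<^sub>1 k\<^sub>2) + i\<^sub>1 (i\<^sub>2 + k\<^sub>2)\<close>, an element of \<open>I\<close> plus an element of \<open>I\<close> times the second factor.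
\<close>

lemma fully_integral_add_square_inside:
  fixes R (structure)
  assumes I: "left_ideal I R" and K: "K \<subseteq> carrier R"
    and KK: "\<And>x y. x \<in> K \<Longrightarrow> y \<in> K \<Longrightarrow> x \<otimes> y \<in> I"
  shows "fully_integral R (I <+>\<^bsub>R\<^esub> K) I"
proof -
  interpret left_ideal I R by fact
  have carr: "I <+>\<^bsub>R\<^esub> K \<subseteq> carrier R" using K by (auto simp: set_add_def')
  let ?W = "{w. set w \<subseteq> {1..2::nat} \<and> length w < 2}"
  have W: "?W = {[], [1], [2]}"
  proof -
    have "w \<in> {[], [1], [2]}" if "set w \<subseteq> {1..2::nat}" "length w < 2" for w
      using that by (cases w) auto
    then show ?thesis by auto
  qed
  have "list_mult R (map a [1..<Suc 2]) \<in> sum_of_sets R ?W (\<lambda>w. set_list_mult R I (map a w))"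
    if a: "a \<in> {1..2} \<rightarrow> (I <+>\<^bsub>R\<^esub> K)" for a
  proof -
    have "a 1 \<in> I <+>\<^bsub>R\<^esub> K" "a 2 \<in> I <+>\<^bsub>R\<^esub> K" using a by auto
    then obtain i1 k1 i2 k2 where i: "i1 \<in> I" "i2 \<in> I" and k: "k1 \<in> K" "k2 \<in> K"
      and a12: "a 1 = i1 \<oplus> k1" "a 2 = i2 \<oplus> k2"
      by (auto simp: set_add_def')
    have mem: "i1 \<in> carrier R" "i2 \<in> carrier R" "k1 \<in> carrier R" "k2 \<in> carrier R"
      using i k K by auto
    let ?u = "k1 \<otimes> i2 \<oplus> k1 \<otimes> k2"
    have u: "?u \<in> I" using i k mem KK by (auto intro!: a_closed l_closed)
    \<comment> \<open>The empty word carries the summand from \<open>I\<close>, the word \<open>[2]\<close> the one from \<open>I\<close> times \<open>a 2\<close>.\<close>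
    define f where
      "f w = (if w = [] then ?u else if w = [2] then i1 \<otimes> a 2 else \<zero>)" for w :: "nat list"
    have "\<zero> = \<zero> \<otimes> a 1" using mem a12 by simp
    then have "\<exists>r \<in> I. f w = foldl (\<otimes>) r (map a w)" if "w \<in> ?W" for w
      using that u i zero_closed unfolding W by (auto simp: f_def)
    then have "f w \<in> set_list_mult R I (map a w)" if "w \<in> ?W" for w
      using that unfolding set_list_mult_def by blast
    then have f: "f \<in> Pi ?W (\<lambda>w. set_list_mult R I (map a w))" by blast
    have "finsum R f ?W = ?u \<oplus> i1 \<otimes> a 2"
      using mem unfolding W by (simp add: f_def a12)
    also have "\<dots> = a 1 \<otimes> a 2"
      unfolding a12 using mem by (simp add: l_distr r_distr a_ac)
    also have "\<dots> = list_mult R (map a [1..<Suc 2])"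
    proof -
      have "map a [1..<Suc 2] = [a 1, a 2]" by (simp add: numeral_2_eq_2)
      moreover have "a 2 \<in> carrier R" using mem a12 by simp
      ultimately show ?thesis by (simp only: list_mult_def foldr.simps comp_def id_def r_one)
    qed
    finally have "list_mult R (map a [1..<Suc 2]) = finsum R f ?W" by (rule sym)
    with f show ?thesis unfolding sum_of_sets_def by (intro CollectI exI[of _ f] conjI)
  qed
  then show ?thesis
    unfolding fully_integral_def using carr by (intro conjI exI[of _ 2] ballI) simp_all
qed

text \<open>
  Let \<open>aRa\<close> lie in the core. Adding \<open>Ra\<close> to \<open>I\<close> would give only \<open>a \<in> I\<close>, which is too weak;
  so the generator is \<open>c = ar\<close> for an arbitrary \<open>r\<close>. Two elements of \<open>Rc\<close> multiply to
  \<open>(s a r)(t a r) = s (a (r t) a) r\<close>, which stays in the core because the core is two-sided.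
  Thus \<open>I + Rc\<close> is fully integral over \<open>I\<close> and must equal \<open>I\<close>.
\<close>

lemma semiprime_left_ideal_core:
  fixes R (structure)
  assumes closed: "fully_integrally_closed R I"
  shows "semiprime_ideal R (left_ideal_core R I)"
proof -
  have I: "left_ideal I R" using closed by (simp add: fully_integrally_closed_def)
  interpret left_ideal I R by fact
  interpret core: ideal "left_ideal_core R I" R by (rule ideal_left_ideal_core)
  have "a \<in> left_ideal_core R I"
    if a: "a \<in> carrier R"
      and aRa: "{a \<otimes> r \<otimes> a | r. r \<in> carrier R} \<subseteq> left_ideal_core R I" for a
  proof -
    have "a \<otimes> r \<in> I" if r: "r \<in> carrier R" for r
    proof -
      let ?c = "a \<otimes> r"
      let ?K = "{s \<otimes> ?c | s. s \<in> carrier R}"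
      have c: "?c \<in> carrier R" using a r by simp
      have K: "left_ideal ?K R" using left_ideal_principal[OF ring_axioms c] .
      have "x \<otimes> y \<in> I" if "x \<in> ?K" "y \<in> ?K" for x y
      proof -
        from that obtain s t where st: "s \<in> carrier R" "t \<in> carrier R"
          and xy: "x = s \<otimes> ?c" "y = t \<otimes> ?c" by blast
        have "a \<otimes> (r \<otimes> t) \<otimes> a \<in> left_ideal_core R I" using aRa r st by blast
        then have "s \<otimes> (a \<otimes> (r \<otimes> t) \<otimes> a \<otimes> r) \<in> left_ideal_core R I"
          using r st by (simp add: core.I_l_closed core.I_r_closed)
        moreover have "x \<otimes> y = s \<otimes> (a \<otimes> (r \<otimes> t) \<otimes> a \<otimes> r)"
          using a r st by (simp add: xy m_assoc)
        ultimately show ?thesis using left_ideal_core_subset by auto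
      qed
      then have int: "fully_integral R (I <+>\<^bsub>R\<^esub> ?K) I"
        using c by (intro fully_integral_add_square_inside[OF I]) auto
      have "I \<subseteq> I <+>\<^bsub>R\<^esub> ?K"
      proof
        fix i assume "i \<in> I"
        moreover from this have "i = i \<oplus> \<zero> \<otimes> ?c" using c by simp
        ultimately show "i \<in> I <+>\<^bsub>R\<^esub> ?K" unfolding set_add_def' by blast
      qed
      with int have "I <+>\<^bsub>R\<^esub> ?K = I"
        using closed left_ideal_set_add[OF I K] unfolding fully_integrally_closed_def by blast
      moreover have "?c \<in> I <+>\<^bsub>R\<^esub> ?K"
      proof -
        have "?c = \<zero> \<oplus> \<one> \<otimes> ?c" using c by simp
        moreover have "\<zero> \<in> I" "\<one> \<otimes> ?c \<in> ?K" by auto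
        ultimately show ?thesis unfolding set_add_def' by blast
      qed
      ultimately show ?thesis by simp
    qed
    then show ?thesis using a unfolding left_ideal_core_def by blast
  qed
  then show ?thesis
    unfolding semiprime_ideal_def by (intro conjI ballI impI core.ideal_axioms)
qed

section \<open>The lower nilradical\<close>

theorem theorem3p25:
  fixes R :: "('a, 'b) ring_scheme"
  assumes "ring R"
  shows "lower_nilradical R = \<Inter> {I. fully_integrally_closed R I}"
proof
  show "\<Inter> {I. fully_integrally_closed R I} \<subseteq> lower_nilradical R"
    unfolding lower_nilradical_def using semiprime_ideal_fully_integrally_closed by blast
  show "lower_nilradical R \<subseteq> \<Inter> {I. fully_integrally_closed R I}"
  proof (rule Inter_greatest)
    fix I assume "I \<in> {I. fully_integrally_closed R I}"
    then have closed: "fully_integrally_closed R I" by simp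
    then have "lower_nilradical R \<subseteq> left_ideal_core R I"
      unfolding lower_nilradical_def using semiprime_left_ideal_core by blast
    also have "\<dots> \<subseteq> I"
      using closed left_ideal.left_ideal_core_subset by (auto simp: fully_integrally_closed_def)
    finally show "lower_nilradical R \<subseteq> I" .
  qed
qed

end
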